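(* Let $q$ be an odd prime power with $q\equiv 1\pmod 3$, let $m=(q-1)/3$, and let $\gamma$ be a generator of the multiplicative group $\mathbf{F}_q^*$. For an integer $k$ with $0\le k\le m-1$, define elements $a_k,b_k,c_k\in\mathbf{F}_q$ by $$a_k=\frac{\gamma^{2m+6k+2}+\gamma^{m+3k+1}+1}{3\gamma^{m+3k+1}},\qquad b_k=\frac{\gamma^{2m}+\gamma^{m+3k+1}+\gamma^{6k+2}}{3\gamma^{m+3k+1}},\qquad c_k=\frac{\gamma^{6k+2}+\gamma^{3k+1}+1}{3\gamma^{3k+1}}.$$ Then the trinomial $g_k(x)=a_kx^{2m+1}+b_kx^{m+1}+c_kx$ is a permutation polynomial over $\mathbf{F}_q$, and the permutation of $\mathbf{F}_q$ it induces is an involution with exactly $m+1$ fixed points.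
   Context: $\mathbf{F}_q$ denotes the finite field with $q$ elements. A permutation polynomial over $\mathbf{F}_q$ is a polynomial $g\in\mathbf{F}_q[x]$ whose associated map $\mathbf{F}_q\to\mathbf{F}_q$, $x\mapsto g(x)$, is a bijection; it is involutory if $g(g(x))=x$ for all $x\in\mathbf{F}_q$. *)

theory Defs
  imports
    "HOL-Computational_Algebra.Polynomial"
    "HOL-Number_Theory.Cong"
    "HOL-Number_Theory.Prime_Powers"
    "HOL-Library.Cardinality"
begin

text \<open>
  The finite field with \<open>q\<close> elements is a type \<open>'a\<close> of classes \<open>finite\<close> and \<open>field\<close>
  with \<open>CARD('a) = q\<close>.
\<close>

definition generates_mult_group :: "'a::field \<Rightarrow> bool" where
  "generates_mult_group \<gamma> \<longleftrightarrow> range (\<lambda>n::int. \<gamma> powi n) = UNIV - {0}"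

definition permutation_poly :: "'a::field poly \<Rightarrow> bool" where
  "permutation_poly g \<longleftrightarrow> bij (poly g)"

definition involutory_poly :: "'a::field poly \<Rightarrow> bool" where
  "involutory_poly g \<longleftrightarrow> (\<forall>x. poly g (poly g x) = x)"

definition fixed_points :: "('a \<Rightarrow> 'a) \<Rightarrow> 'a set" where
  "fixed_points f = {x. f x = x}"

definition coeff_a :: "'a::field \<Rightarrow> nat \<Rightarrow> nat \<Rightarrow> 'a" where
  "coeff_a \<gamma> m k =
     (\<gamma> ^ (2 * m + 6 * k + 2) + \<gamma> ^ (m + 3 * k + 1) + 1) / (3 * \<gamma> ^ (m + 3 * k + 1))"

definition coeff_b :: "'a::field \<Rightarrow> nat \<Rightarrow> nat \<Rightarrow> 'a" where
  "coeff_b \<gamma> m k =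
     (\<gamma> ^ (2 * m) + \<gamma> ^ (m + 3 * k + 1) + \<gamma> ^ (6 * k + 2)) / (3 * \<gamma> ^ (m + 3 * k + 1))"

definition coeff_c :: "'a::field \<Rightarrow> nat \<Rightarrow> 'a" where
  "coeff_c \<gamma> k = (\<gamma> ^ (6 * k + 2) + \<gamma> ^ (3 * k + 1) + 1) / (3 * \<gamma> ^ (3 * k + 1))"

definition trinomial :: "'a::field \<Rightarrow> nat \<Rightarrow> nat \<Rightarrow> 'a poly" where
  "trinomial \<gamma> m k =
     monom (coeff_a \<gamma> m k) (2 * m + 1) + monom (coeff_b \<gamma> m k) (m + 1) + monom (coeff_c \<gamma> k) 1"

end

theory Submission
  imports Defs
begin

text \<open>
  Write \<open>\<omega> = \<gamma>\<^sup>m\<close>, a primitive cube root of unity, and \<open>t = \<gamma>\<^bsup>3k+1\<^esup>\<close>, so that \<open>t\<^sup>m = \<omega>\<close>.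
  Then \<open>g(x) = x h(x\<^sup>m)\<close>, where the quadratic \<open>h\<close> interpolates \<open>1, t, 1/t\<close> at \<open>1, \<omega>, \<omega>\<^sup>2\<close>.
  Hence \<open>g\<close> fixes \<open>0\<close> and the cubes, multiplies the coset \<open>x\<^sup>m = \<omega>\<close> by \<open>t\<close>, which takes it
  to the coset \<open>x\<^sup>m = \<omega>\<^sup>2\<close>, and multiplies the latter by \<open>1/t\<close>.
\<close>

text \<open>Multiplication by \<open>x\<close> permutes the nonzero elements, so their product
  equals itself times \<open>x ^ (CARD('a) - 1)\<close>; the product is nonzero and cancels.\<close>

lemma power_card_minus_one:
  fixes x :: "'a::{finite, field}"
  assumes "x \<noteq> 0"
  shows "x ^ (CARD('a) - 1) = 1"
proof -
  let ?S = "UNIV - {0::'a}"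
  have bij: "bij_betw ((*) x) ?S ?S"
    by (rule bij_betwI[where g = "\<lambda>y. y / x"]) (use assms in auto)
  have "\<Prod>?S = (\<Prod>y\<in>?S. x * y)"
    using prod.reindex_bij_betw[OF bij, of "\<lambda>y. y"] by simp
  also have "\<dots> = x ^ (CARD('a) - 1) * \<Prod>?S"
    by (simp add: prod.distrib card_Diff_singleton)
  finally show ?thesis
    by simp
qed

lemma generator_nonzero:
  assumes "generates_mult_group \<gamma>"
  shows "\<gamma> \<noteq> 0"
proof
  assume "\<gamma> = 0"
  then have "\<gamma> powi 1 = 0" by simp
  then show False
    using assms unfolding generates_mult_group_def by blast
qed

text \<open>Integer exponents reduce to their remainder modulo \<open>CARD('a) - 1\<close>, since
  the quotient contributes a power of 1. The exponent range has as many members as there are nonzero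
  elements, so injectivity then follows by counting.\<close>

lemma generator_powers_eq:
  fixes \<gamma> :: "'a::{finite, field}"
  assumes "generates_mult_group \<gamma>"
  shows "(\<lambda>n. \<gamma> ^ n) ` {..<CARD('a) - 1} = UNIV - {0}"
proof -
  let ?N = "CARD('a) - 1"
  note nz = generator_nonzero[OF assms]
  have N: "?N > 0"
    using card_mono[of "UNIV :: 'a set" "{0, 1}"] by simp
  have "x \<in> (\<lambda>n. \<gamma> ^ n) ` {..<?N}" if x: "x \<noteq> 0" for x
  proof -
    obtain n :: int where n: "x = \<gamma> powi n"
      using assms x unfolding generates_mult_group_def by blast
    have "\<gamma> powi n = \<gamma> powi (int ?N * (n div int ?N) + n mod int ?N)"
      by simp
    also have "\<dots> = (\<gamma> powi int ?N) powi (n div int ?N) * \<gamma> powi (n mod int ?N)"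
      using nz by (simp only: power_int_add power_int_mult simp_thms)
    also have "\<gamma> powi int ?N = 1"
      unfolding power_int_of_nat by (rule power_card_minus_one[OF nz])
    also have "\<gamma> powi (n mod int ?N) = \<gamma> ^ nat (n mod int ?N)"
      using N by (simp add: power_int_def)
    finally have "x = \<gamma> ^ nat (n mod int ?N)"
      using n by simp
    moreover have "nat (n mod int ?N) < ?N"
      using N by (simp add: nat_less_iff)
    ultimately show ?thesis by blast
  qed
  then show ?thesis
    using nz by auto
qed

lemma generator_powers_inj:
  fixes \<gamma> :: "'a::{finite, field}"
  assumes "generates_mult_group \<gamma>"
  shows "inj_on (\<lambda>n. \<gamma> ^ n) {..<CARD('a) - 1}"
  by (rule eq_card_imp_inj_on)
    (simp_all only: generator_powers_eq[OF assms] card_Diff_singleton finite_lessThan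
      card_lessThan UNIV_I)

text \<open>The coefficients are the inverse discrete Fourier transform, over the cube roots of
  unity, of the values 1, \<open>t\<close>, \<open>1 / t\<close>, cleared of denominators by
  \<open>w ^ 3 = 1\<close>.\<close>

lemma trinomial_interpolation:
  fixes w t :: "'a::field"
  assumes w: "w ^ 2 + w + 1 = 0" and w1: "w \<noteq> 1" and t: "t \<noteq> 0"
  defines "h \<equiv> \<lambda>y. (w ^ 2 * t ^ 2 + w * t + 1) / (3 * (w * t)) * y ^ 2
      + (w ^ 2 + w * t + t ^ 2) / (3 * (w * t)) * y + (t ^ 2 + t + 1) / (3 * t)"
  shows "h 1 = 1" and "h w = t" and "h (w ^ 2) = 1 / t"
proof -
  have w0: "w \<noteq> 0"
    using w by auto
  \<comment> \<open>In characteristic 3, \<open>w ^ 2 + w + 1\<close> is the square of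
    \<open>w - 1\<close>, which would force \<open>w = 1\<close>.\<close>
  have three: "(3::'a) \<noteq> 0"
  proof
    assume 3: "(3::'a) = 0"
    have "(w - 1) ^ 2 = (w ^ 2 + w + 1) - 3 * w" by algebra
    then show False using 3 w w1 by simp
  qed
  let ?d = "3 * (w * t)"
  have d: "?d \<noteq> 0"
    using w0 t three by simp
  have h: "h y = ((w ^ 2 * t ^ 2 + w * t + 1) * y ^ 2 + (w ^ 2 + w * t + t ^ 2) * y
      + w * (t ^ 2 + t + 1)) / ?d" for y
  proof -
    have "(t ^ 2 + t + 1) / (3 * t) = w * (t ^ 2 + t + 1) / ?d"
      using w0 by simp
    then show ?thesis
      unfolding h_def by (simp only: times_divide_eq_left add_divide_distrib[symmetric])
  qed
  \<comment> \<open>Here and in the next two evaluations, the numerator minus the expected value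
    times \<open>?d\<close> is divisible by \<open>w ^ 2 + w + 1\<close>; the last factor is the
    quotient.\<close>
  have "(w ^ 2 * t ^ 2 + w * t + 1) * 1 ^ 2 + (w ^ 2 + w * t + t ^ 2) * 1
      + w * (t ^ 2 + t + 1) = ?d + (w ^ 2 + w + 1) * (t ^ 2 + 1)"
    by (simp add: algebra_simps)
  then show "h 1 = 1"
    unfolding h using d w by simp
  have "(w ^ 2 * t ^ 2 + w * t + 1) * w ^ 2 + (w ^ 2 + w * t + t ^ 2) * w
      + w * (t ^ 2 + t + 1) = t * ?d + (w ^ 2 + w + 1) * ((w ^ 2 - w) * t ^ 2 + w * t + w)"
    by algebra
  then show "h w = t"
    unfolding h using d w by simp
  have "(w ^ 2 * t ^ 2 + w * t + 1) * (w ^ 2) ^ 2 + (w ^ 2 + w * t + t ^ 2) * w ^ 2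
      + w * (t ^ 2 + t + 1) = 3 * w + (w ^ 2 + w + 1)
      * ((w ^ 4 - w ^ 3 + w) * t ^ 2 + (w ^ 3 - w ^ 2 + w) * t + 2 * (w ^ 2 - w))"
    by algebra
  then show "h (w ^ 2) = 1 / t"
    unfolding h using three w0 t w by simp
qed

theorem theorem2p1:
  fixes \<gamma> :: "'a::{finite, field}" and q m k :: nat
  assumes "CARD('a) = q"
    and "primepow q" and "odd q" and "[q = 1] (mod 3)"
    and "m = (q - 1) div 3"
    and "generates_mult_group \<gamma>"
    and "k \<le> m - 1"
  shows "permutation_poly (trinomial \<gamma> m k) \<and>
         involutory_poly (trinomial \<gamma> m k) \<and>
         card (fixed_points (poly (trinomial \<gamma> m k))) = m + 1"
proof -
  have q2: "q \<ge> 2"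
    using card_mono[of "UNIV :: 'a set" "{0, 1}"] assms(1) by simp
  have qm: "q - 1 = 3 * m" and m: "m > 0"
    using assms(4,5) q2 unfolding cong_def by presburger+
  have surj: "(\<lambda>n. \<gamma> ^ n) ` {..<3 * m} = UNIV - {0}"
    using generator_powers_eq[OF assms(6)] assms(1) qm by simp
  have inj: "inj_on (\<lambda>n. \<gamma> ^ n) {..<3 * m}"
    using generator_powers_inj[OF assms(6)] assms(1) qm by simp
  note nz = generator_nonzero[OF assms(6)]
  define w where "w = \<gamma> ^ m"
  define t where "t = \<gamma> ^ (3 * k + 1)"
  have w3: "w ^ 3 = 1"
    using power_card_minus_one[OF nz] assms(1) qm
    by (simp add: w_def flip: power_mult) (simp add: mult.commute)
  have w1: "w \<noteq> 1"
    using inj_onD[OF inj, of m 0] m by (auto simp: w_def)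
  have w: "w ^ 2 + w + 1 = 0"
  proof -
    have "(w - 1) * (w ^ 2 + w + 1) = 0" using w3 by algebra
    then show ?thesis using w1 by simp
  qed
  have w21: "w ^ 2 \<noteq> 1"
  proof
    assume "w ^ 2 = 1"
    then have "w ^ 3 = w" by (simp add: power3_eq_cube power2_eq_square)
    then show False using w3 w1 by simp
  qed
  have t0: "t \<noteq> 0"
    using nz by (simp add: t_def)
  \<comment> \<open>Only the residue 1 of the exponent \<open>3 * k + 1\<close> modulo 3 matters: it
    makes multiplication by \<open>t\<close> multiply \<open>x ^ m\<close> by
    \<open>w\<close>.\<close>
  have tm: "t ^ m = w"
  proof -
    have "t ^ m = w ^ (3 * k + 1)"
      unfolding t_def w_def by (simp only: mult.commute flip: power_mult)
    then show ?thesis using w3 by (simp add: power_add power_mult)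
  qed
  have t1: "t \<noteq> 1"
    using tm w1 by auto
  have w_pow: "w ^ i = (if i mod 3 = 0 then 1 else if i mod 3 = 1 then w else w ^ 2)" for i
  proof -
    have "w ^ i = w ^ (3 * (i div 3) + i mod 3)" by simp
    also have "\<dots> = w ^ (i mod 3)"
      using w3 by (simp only: power_add power_mult power_one mult_1)
    finally have "w ^ i = w ^ (i mod 3)" .
    moreover have "i mod 3 = 0 \<or> i mod 3 = 1 \<or> i mod 3 = 2"
      by presburger
    ultimately show ?thesis
      by (elim disjE) (simp_all only: power_0 power_one_right simp_thms if_True if_False
        one_neq_zero zero_neq_numeral numeral_eq_one_iff refl, simp_all)
  qed
  \<comment> \<open>For \<open>x = \<gamma> ^ i\<close> one has \<open>x ^ m = w ^ i\<close>, which
    depends on \<open>i mod 3\<close> only.\<close>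
  have cosets: "x ^ m = 1 \<or> x ^ m = w \<or> x ^ m = w ^ 2" if "x \<noteq> 0" for x
  proof -
    have "x \<in> (\<lambda>n. \<gamma> ^ n) ` {..<3 * m}"
      unfolding surj using that by simp
    then obtain i where "x = \<gamma> ^ i"
      by blast
    then have "x ^ m = w ^ i"
      unfolding w_def by (simp add: mult.commute flip: power_mult)
    then show ?thesis using w_pow[of i] by presburger
  qed
  define g where "g = poly (trinomial \<gamma> m k)"
  define h where "h = (\<lambda>y. (w ^ 2 * t ^ 2 + w * t + 1) / (3 * (w * t)) * y ^ 2
      + (w ^ 2 + w * t + t ^ 2) / (3 * (w * t)) * y + (t ^ 2 + t + 1) / (3 * t))"
  have powers: "\<gamma> ^ (2 * m + 6 * k + 2) = w ^ 2 * t ^ 2" "\<gamma> ^ (m + 3 * k + 1) = w * t"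
    "\<gamma> ^ (2 * m) = w ^ 2" "\<gamma> ^ (6 * k + 2) = t ^ 2"
    unfolding w_def t_def power_add[symmetric] power_mult[symmetric]
    by (simp_all add: algebra_simps)
  have g: "g x = x * h (x ^ m)" for x
  proof -
    have "x ^ (2 * m + 1) = x * (x ^ m) ^ 2" "x ^ (m + 1) = x * x ^ m"
      by (simp_all add: mult.commute flip: power_mult)
    then show ?thesis
      unfolding g_def h_def trinomial_def coeff_a_def coeff_b_def coeff_c_def powers
        t_def[symmetric] poly_add poly_monom
      by (simp only: distrib_left mult_ac power_one_right)
  qed
  have h: "h 1 = 1" "h w = t" "h (w ^ 2) = 1 / t"
    unfolding h_def by (rule trinomial_interpolation[OF w w1 t0])+
  have g_cube: "g x = x" if "x ^ m = 1" for x
    by (simp add: g that h)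
  have g_w: "g x = x * t" if "x ^ m = w" for x
    by (simp add: g that h)
  have g_w2: "g x = x / t" if "x ^ m = w ^ 2" for x
    by (simp add: g that h)
  have g0: "g 0 = 0"
    by (simp add: g)
  have inv: "g (g x) = x" for x
  proof (cases "x = 0")
    case False
    then consider "x ^ m = 1" | "x ^ m = w" | "x ^ m = w ^ 2"
      using cosets by blast
    then show ?thesis
    proof cases
      case 1
      then show ?thesis by (simp add: g_cube)
    next
      case 2
      then have "(x * t) ^ m = w ^ 2"
        by (simp add: power_mult_distrib tm power2_eq_square)
      then show ?thesis using 2 t0 by (simp add: g_w g_w2)
    next
      case 3
      then have "(x / t) ^ m = w"
        by (simp add: power_divide tm power2_eq_square)
      then show ?thesis using 3 t0 by (simp add: g_w g_w2)
    qed
  qed (simp add: g0)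
  \<comment> \<open>A nonzero fixed point outside the cubes would satisfy \<open>x * t = x\<close>
    or \<open>x / t = x\<close>, against \<open>t \<noteq> 1\<close>.\<close>
  have fixed: "fixed_points g = insert 0 {x. x ^ m = 1}"
  proof -
    have "x ^ m = 1" if "g x = x" "x \<noteq> 0" for x
      using cosets[OF that(2)] that t0 t1 by (auto simp: g_w g_w2 field_simps)
    then show ?thesis
      by (auto simp: fixed_points_def g0 g_cube)
  qed
  \<comment> \<open>\<open>w\<close> has order 3, so the solutions are the powers whose exponent is
    divisible by 3; below \<open>3 * m\<close> there are \<open>m\<close> such exponents.\<close>
  have "{x. x ^ m = 1} = (\<lambda>j. \<gamma> ^ (3 * j)) ` {..<m}"
  proof (intro equalityI subsetI)
    fix x :: 'a
    assume "x \<in> {x. x ^ m = 1}"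
    then have x: "x ^ m = 1" by simp
    then have "x \<noteq> 0" using m by (auto simp: power_0_left)
    then have "x \<in> (\<lambda>n. \<gamma> ^ n) ` {..<3 * m}"
      unfolding surj by simp
    then obtain i where i: "x = \<gamma> ^ i" "i < 3 * m"
      by blast
    then have "w ^ i = 1"
      using x unfolding w_def by (simp add: mult.commute flip: power_mult)
    then have "i mod 3 = 0"
      using w_pow[of i] w1 w21 by (auto split: if_splits)
    then have "i = 3 * (i div 3)" by presburger
    then show "x \<in> (\<lambda>j. \<gamma> ^ (3 * j)) ` {..<m}"
      using i by (intro image_eqI[of _ _ "i div 3"]) auto
  next
    fix x :: 'a
    assume "x \<in> (\<lambda>j. \<gamma> ^ (3 * j)) ` {..<m}"
    then obtain j where "x = \<gamma> ^ (3 * j)" by blast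
    then have "x ^ m = (w ^ 3) ^ j"
      unfolding w_def by (simp add: mult_ac flip: power_mult)
    then show "x \<in> {x. x ^ m = 1}" by (simp add: w3)
  qed
  moreover have "inj_on (\<lambda>j. \<gamma> ^ (3 * j)) {..<m}"
    by (rule inj_onI) (use inj_onD[OF inj, of "3 * _" "3 * _"] in auto)
  ultimately have "card {x::'a. x ^ m = 1} = m"
    by (simp add: card_image)
  \<comment> \<open>Since \<open>m > 0\<close>, \<open>0 ^ m\<close> is 0 and not 1, so 0 is a new
    fixed point beside the \<open>m\<close> cubes.\<close>
  then have "card (fixed_points g) = m + 1"
    unfolding fixed using m by (simp add: power_0_left)
  moreover have "bij g"
    by (rule o_bij[of g g]) (simp_all add: fun_eq_iff inv)
  ultimately show ?thesis
    using inv by (simp add: permutation_poly_def involutory_poly_def g_def)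
qed

end
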